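(* Let $n\ge1$ be an integer, let $a_0$, $\rho\ne0$, $\alpha$, $\beta$ be complex parameters with $\beta\notin\{0,-1,-2,\dots\}$, and let $$a_m=a_0\,\rho^m\,\frac{(\alpha)_m}{(\beta)_m}\qquad(m\ge0).$$ Let $0\le x_0<x_1<\dots<x_{n-1}$ be integers. Then $$\det\bigl(a_{x_i+j}\bigr)_{0\le i,j\le n-1} =\rho^{\binom n2}\,\prod_{i=0}^{n-1}(\beta-\alpha)_i\; \prod_{0\le i<j\le n-1}(x_j-x_i)\; \prod_{i=0}^{n-1}\frac{a_{x_i}}{(x_i+\beta)_{n-1}}.$$
   Context: $(\gamma)_m=\gamma(\gamma+1)\cdots(\gamma+m-1)$ is the Pochhammer symbol, with $(\gamma)_0=1$; empty products equal $1$. *)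

theory Defs
  imports Complex_Main "HOL-Library.Nonpos_Ints" "Jordan_Normal_Form.Determinant"
begin

end

(*
  Pulling a_{x_i} / (x_i + \<beta>)_{n-1} out of row i leaves the entries
  \<rho>^j (u + \<alpha>)_j (u + \<beta> + j)_{n-1-j} with u = x_i. Expanding the last factor by the Chu-Vandermonde
  identity in terms of (u + \<alpha> + j)_l expresses column j as a combination, with coefficients
  independent of u, of the columns (u + \<alpha>)_k with k \<ge> j: the coefficient matrix is triangular
  with diagonal entries \<rho>^j (\<beta> - \<alpha>)_{n-1-j}, and det ((x_i + \<alpha>)_k) is a Vandermonde determinant.
*)

theory Submission
  imports Defs
begin

text \<open>Entrywise form of the multiplicativity of \<open>det\<close>: rewriting columns as
  combinations of the columns of \<open>f\<close> costs the factor \<open>det\<close> of the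
  coefficients \<open>c\<close>.\<close>

lemma det_mat_mult_sum:
  fixes f c :: "nat \<Rightarrow> nat \<Rightarrow> 'a :: comm_ring_1"
  shows "det (mat n n (\<lambda>(i, j). \<Sum>k<n. f i k * c k j)) =
    det (mat n n (\<lambda>(i, j). f i j)) * det (mat n n (\<lambda>(i, j). c i j))"
proof -
  have "mat n n (\<lambda>(i, j). \<Sum>k<n. f i k * c k j) =
      mat n n (\<lambda>(i, j). f i j) * mat n n (\<lambda>(i, j). c i j)"
    by (intro eq_matI) (auto simp: scalar_prod_def lessThan_atLeast0)
  then show ?thesis
    by (simp add: det_mult[of _ n])
qed

lemma det_mat_row_scale:
  fixes f :: "nat \<Rightarrow> nat \<Rightarrow> 'a :: comm_ring_1"
  shows "det (mat n n (\<lambda>(i, j). r i * f i j)) = (\<Prod>i<n. r i) * det (mat n n (\<lambda>(i, j). f i j))"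
proof -
  \<comment> \<open>Each Leibniz term takes one entry from every row, so it contains each
    \<open>r i\<close> exactly once.\<close>
  have "(\<Prod>i = 0..<n. mat n n (\<lambda>(i, j). r i * f i j) $$ (i, p i)) =
      (\<Prod>i<n. r i) * (\<Prod>i = 0..<n. mat n n (\<lambda>(i, j). f i j) $$ (i, p i))"
    if "p permutes {0..<n}" for p
  proof -
    have "p i < n" if "i < n" for i
      using permutes_in_image[OF \<open>p permutes {0..<n}\<close>, of i] that by simp
    then show ?thesis
      by (simp add: lessThan_atLeast0 prod.distrib)
  qed
  then show ?thesis
    unfolding det_def'[OF mat_carrier] sum_distrib_left
    by (intro sum.cong refl) (simp only: mem_Collect_eq mult.left_commute)
qed

lemma det_mat_lower_triangular:
  fixes c :: "nat \<Rightarrow> nat \<Rightarrow> 'a :: comm_ring_1"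
  assumes "\<And>i j. i < j \<Longrightarrow> j < n \<Longrightarrow> c i j = 0"
  shows "det (mat n n (\<lambda>(i, j). c i j)) = (\<Prod>i<n. c i i)"
  using det_lower_triangular[of n "mat n n (\<lambda>(i, j). c i j)"] assms
  by (simp add: prod_list_diag_prod lessThan_atLeast0)

lemma det_mat_upper_triangular:
  fixes c :: "nat \<Rightarrow> nat \<Rightarrow> 'a :: comm_ring_1"
  assumes "\<And>i j. j < i \<Longrightarrow> i < n \<Longrightarrow> c i j = 0"
  shows "det (mat n n (\<lambda>(i, j). c i j)) = (\<Prod>i<n. c i i)"
proof -
  have "det (mat n n (\<lambda>(i, j). c i j)) = det (transpose_mat (mat n n (\<lambda>(i, j). c i j)))"
    by (rule det_transpose[symmetric]) (rule mat_carrier)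
  also have "transpose_mat (mat n n (\<lambda>(i, j). c i j)) = mat n n (\<lambda>(i, j). c j i)"
    by (intro eq_matI) auto
  finally show ?thesis
    using assms by (simp add: det_mat_lower_triangular)
qed

text \<open>The coefficients of \<open>p j\<close> express column \<open>j\<close> through the power
  columns; the degree condition makes this change of basis triangular, and monicity puts ones on its
  diagonal.\<close>

lemma det_poly_monic:
  fixes u :: "nat \<Rightarrow> 'a :: comm_ring_1"
  assumes deg: "\<And>j. j < n \<Longrightarrow> degree (p j) = j" and lead: "\<And>j. j < n \<Longrightarrow> lead_coeff (p j) = 1"
  shows "det (mat n n (\<lambda>(i, j). poly (p j) (u i))) = det (mat n n (\<lambda>(i, j). u i ^ j))"
proof -
  have "poly (p j) (u i) = (\<Sum>k<n. u i ^ k * coeff (p j) k)" if "j < n" for i j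
  proof -
    have "poly (p j) (u i) = (\<Sum>k\<le>j. u i ^ k * coeff (p j) k)"
      using that by (simp add: poly_altdef deg mult.commute)
    also have "\<dots> = (\<Sum>k<n. u i ^ k * coeff (p j) k)"
      using that by (intro sum.mono_neutral_left) (auto simp: deg coeff_eq_0)
    finally show ?thesis .
  qed
  then have "det (mat n n (\<lambda>(i, j). poly (p j) (u i))) =
      det (mat n n (\<lambda>(i, j). \<Sum>k<n. u i ^ k * coeff (p j) k))"
    by (intro arg_cong[of _ _ det] eq_matI) auto
  also have "\<dots> = det (mat n n (\<lambda>(i, j). u i ^ j)) * (\<Prod>j<n. coeff (p j) j)"
    by (simp add: det_mat_mult_sum det_mat_upper_triangular deg coeff_eq_0)
  also have "(\<Prod>j<n. coeff (p j) j) = 1"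
    using deg lead by (intro prod.neutral) (metis lessThan_iff)
  finally show ?thesis
    by simp
qed

text \<open>Newton polynomials are monic of degree \<open>j\<close> whatever the nodes
  \<open>b\<close> are, so the nodes may be chosen to suit each application.\<close>

lemma det_newton_basis:
  fixes u b :: "nat \<Rightarrow> 'a :: idom"
  shows "det (mat n n (\<lambda>(i, j). \<Prod>k<j. u i - b k)) = det (mat n n (\<lambda>(i, j). u i ^ j))"
proof -
  let ?p = "\<lambda>j. \<Prod>k<j. [:- b k, 1:]"
  have "degree (?p j) = j" for j
    by (simp add: degree_prod_sum_eq)
  moreover have "lead_coeff (?p j) = 1" for j
    by (simp only: lead_coeff_prod) simp
  ultimately have "det (mat n n (\<lambda>(i, j). poly (?p j) (u i))) = det (mat n n (\<lambda>(i, j). u i ^ j))"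
    by (intro det_poly_monic)
  then show ?thesis
    by (simp add: poly_prod)
qed

text \<open>With the nodes \<open>b = u\<close> the Newton basis makes the matrix triangular.\<close>

lemma det_vandermonde:
  fixes u :: "nat \<Rightarrow> 'a :: idom"
  shows "det (mat n n (\<lambda>(i, j). u i ^ j)) = (\<Prod>j<n. \<Prod>k<j. u j - u k)"
proof -
  have "det (mat n n (\<lambda>(i, j). \<Prod>k<j. u i - u k)) = (\<Prod>j<n. \<Prod>k<j. u j - u k)"
    by (intro det_mat_lower_triangular prod_zero) auto
  then show ?thesis
    by (simp add: det_newton_basis)
qed

text \<open>Rising factorials are Newton polynomials with nodes -\<alpha> - k.\<close>

lemma det_pochhammer:
  fixes u :: "nat \<Rightarrow> 'a :: idom"
  shows "det (mat n n (\<lambda>(i, j). pochhammer (u i + \<alpha>) j)) = (\<Prod>j<n. \<Prod>k<j. u j - u k)"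
proof -
  have "pochhammer (u i + \<alpha>) j = (\<Prod>k<j. u i - (- \<alpha> - of_nat k))" for i j
    by (simp add: pochhammer_prod lessThan_atLeast0 algebra_simps)
  then show ?thesis
    by (simp only: det_newton_basis det_vandermonde)
qed

text \<open>Chu-Vandermonde, padded with zeros for \<open>k < j\<close> so that the sum has the
  shape of a matrix product; \<open>u\<close> occurs only in the first factor.\<close>

lemma pochhammer_mult_expansion:
  fixes u \<alpha> \<beta> :: "'a :: comm_ring_1"
  assumes "j < n"
  shows "pochhammer (u + \<alpha>) j * pochhammer (u + \<beta> + of_nat j) (n - 1 - j) =
    (\<Sum>k<n. pochhammer (u + \<alpha>) k *
      (if j \<le> k then of_nat ((n - 1 - j) choose (k - j)) * pochhammer (\<beta> - \<alpha>) (n - 1 - k) else 0))"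
    (is "_ = (\<Sum>k<n. ?t k)")
proof -
  \<comment> \<open>The argument is split so that its first part continues
    \<open>pochhammer (u + \<alpha>) j\<close>, and the rest does not involve
    \<open>u\<close>.\<close>
  have "pochhammer (u + \<beta> + of_nat j) (n - 1 - j) =
      pochhammer ((u + \<alpha> + of_nat j) + (\<beta> - \<alpha>)) (n - 1 - j)"
    by (simp add: algebra_simps)
  also have "\<dots> = (\<Sum>l\<le>n - 1 - j. of_nat ((n - 1 - j) choose l) *
      pochhammer (u + \<alpha> + of_nat j) l * pochhammer (\<beta> - \<alpha>) (n - 1 - j - l))"
    by (rule pochhammer_binomial_sum)
  finally have "pochhammer (u + \<alpha>) j * pochhammer (u + \<beta> + of_nat j) (n - 1 - j) =
      (\<Sum>l\<le>n - 1 - j. pochhammer (u + \<alpha>) (j + l) *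
        (of_nat ((n - 1 - j) choose l) * pochhammer (\<beta> - \<alpha>) (n - 1 - j - l)))"
    by (simp only: pochhammer_product' sum_distrib_left) (simp only: mult_ac)
  also have "\<dots> = (\<Sum>l\<le>n - 1 - j. ?t (l + j))"
    by (simp add: add.commute)
  \<comment> \<open>Substitute k = l + j; since \<open>j < n\<close>, the subtraction in the bound
    is not truncated.\<close>
  also have "\<dots> = (\<Sum>k\<in>{j..<n}. ?t k)"
    using assms by (intro sum.reindex_bij_witness[of _ "\<lambda>k. k - j" "\<lambda>l. l + j"]) auto
  also have "\<dots> = (\<Sum>k<n. ?t k)"
    by (intro sum.mono_neutral_left) auto
  finally show ?thesis .
qed

lemma det_pochhammer_mult:
  fixes u :: "nat \<Rightarrow> 'a :: idom"
  shows "det (mat n n (\<lambda>(i, j). \<rho> ^ j *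
      (pochhammer (u i + \<alpha>) j * pochhammer (u i + \<beta> + of_nat j) (n - 1 - j)))) =
    \<rho> ^ (n choose 2) * (\<Prod>i<n. pochhammer (\<beta> - \<alpha>) i) * (\<Prod>j<n. \<Prod>k<j. u j - u k)"
proof -
  define c where "c k j = \<rho> ^ j *
    (if j \<le> k then of_nat ((n - 1 - j) choose (k - j)) * pochhammer (\<beta> - \<alpha>) (n - 1 - k) else 0)"
    for k j
  have "\<rho> ^ j * (pochhammer (u i + \<alpha>) j * pochhammer (u i + \<beta> + of_nat j) (n - 1 - j)) =
      (\<Sum>k<n. pochhammer (u i + \<alpha>) k * c k j)" if "j < n" for i j
    unfolding pochhammer_mult_expansion[OF that] c_def
    by (simp add: sum_distrib_left mult.left_commute)
  then have "det (mat n n (\<lambda>(i, j). \<rho> ^ j *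
      (pochhammer (u i + \<alpha>) j * pochhammer (u i + \<beta> + of_nat j) (n - 1 - j)))) =
      det (mat n n (\<lambda>(i, j). \<Sum>k<n. pochhammer (u i + \<alpha>) k * c k j))"
    by (intro arg_cong[of _ _ det] eq_matI) auto
  also have "\<dots> = (\<Prod>j<n. \<Prod>k<j. u j - u k) * (\<Prod>j<n. c j j)"
    by (simp add: det_mat_mult_sum det_pochhammer det_mat_lower_triangular c_def)
  \<comment> \<open>On the diagonal the binomial coefficient is 1.\<close>
  also have "(\<Prod>j<n. c j j) = \<rho> ^ (\<Sum>j<n. j) * (\<Prod>j<n. pochhammer (\<beta> - \<alpha>) (n - 1 - j))"
    by (simp add: c_def prod.distrib power_sum)
  also have "(\<Sum>j<n. j) = n choose 2"
    by (simp add: lessThan_atLeast0 Sum_Ico_nat choose_two)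
  also have "(\<Prod>j<n. pochhammer (\<beta> - \<alpha>) (n - 1 - j)) = (\<Prod>i<n. pochhammer (\<beta> - \<alpha>) i)"
    by (rule prod.reindex_bij_witness[of _ "\<lambda>i. n - 1 - i" "\<lambda>i. n - 1 - i"]) auto
  finally show ?thesis
    by (simp add: mult_ac)
qed

theorem theorem4p1:
  fixes n :: nat and a0 \<rho> \<alpha> \<beta> :: complex
    and a :: "nat \<Rightarrow> complex" and x :: "nat \<Rightarrow> nat"
  assumes "n \<ge> 1"
    and "\<rho> \<noteq> 0"
    and "\<beta> \<notin> \<int>\<^sub>\<le>\<^sub>0"
    and "\<And>m. a m = a0 * \<rho> ^ m * (pochhammer \<alpha> m / pochhammer \<beta> m)"
    and "strict_mono_on {..<n} x"
  shows "det (mat n n (\<lambda>(i, j). a (x i + j))) =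
    \<rho> ^ (n choose 2)
    * (\<Prod>i<n. pochhammer (\<beta> - \<alpha>) i)
    * (\<Prod>(i, j) \<in> {(i, j). i < j \<and> j < n}. of_nat (x j) - of_nat (x i))
    * (\<Prod>i<n. a (x i) / pochhammer (of_nat (x i) + \<beta>) (n - 1))"
proof -
  define u :: "nat \<Rightarrow> complex" where "u i = of_nat (x i)" for i
  have nz: "pochhammer \<beta> m \<noteq> 0" for m
    using assms(3) by (auto simp: pochhammer_eq_0_iff)
  have entry: "a (x i + j) = a (x i) / pochhammer (u i + \<beta>) (n - 1) *
      (\<rho> ^ j * (pochhammer (u i + \<alpha>) j * pochhammer (u i + \<beta> + of_nat j) (n - 1 - j)))"
    if "j < n" for i j
  proof -
    have split_n: "pochhammer (u i + \<beta>) (n - 1) =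
        pochhammer (u i + \<beta>) j * pochhammer (u i + \<beta> + of_nat j) (n - 1 - j)"
      using that by (intro pochhammer_product) simp
    have split_x: "pochhammer \<gamma> (x i + m) = pochhammer \<gamma> (x i) * pochhammer (u i + \<gamma>) m" for \<gamma> m
      unfolding u_def add.commute[of _ \<gamma>] by (rule pochhammer_product')
    \<comment> \<open>It divides \<open>pochhammer \<beta> (x i + (n - 1))\<close>, which is nonzero
      by \<open>nz\<close>.\<close>
    have "pochhammer (u i + \<beta>) (n - 1) \<noteq> 0"
      using nz[of "x i + (n - 1)"] unfolding split_x by simp
    then have "pochhammer (u i + \<beta>) j \<noteq> 0" "pochhammer (u i + \<beta> + of_nat j) (n - 1 - j) \<noteq> 0"
      unfolding split_n by simp_all
    \<comment> \<open>By \<open>split_x\<close>, passing from \<open>a (x i)\<close> to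
      \<open>a (x i + j)\<close> multiplies by \<rho>^j (u + \<alpha>)_j / (u + \<beta>)_j;
      expanding this fraction by the second factor of \<open>split_n\<close> gives the
      claim.\<close>
    then show ?thesis
      unfolding assms(4) split_x split_n by (simp add: power_add)
  qed
  have "det (mat n n (\<lambda>(i, j). a (x i + j))) =
      det (mat n n (\<lambda>(i, j). a (x i) / pochhammer (u i + \<beta>) (n - 1) *
        (\<rho> ^ j * (pochhammer (u i + \<alpha>) j * pochhammer (u i + \<beta> + of_nat j) (n - 1 - j)))))"
    using entry by (intro arg_cong[of _ _ det] eq_matI) auto
  also have "\<dots> = (\<Prod>i<n. a (x i) / pochhammer (u i + \<beta>) (n - 1)) *
      (\<rho> ^ (n choose 2) * (\<Prod>i<n. pochhammer (\<beta> - \<alpha>) i) * (\<Prod>j<n. \<Prod>k<j. u j - u k))"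
    by (simp only: det_mat_row_scale det_pochhammer_mult)
  \<comment> \<open>The nested product lists the larger index first, so the pairs are swapped to
    match the index set of the theorem.\<close>
  also have "(\<Prod>j<n. \<Prod>k<j. u j - u k) = (\<Prod>(j, k) \<in> Sigma {..<n} lessThan. u j - u k)"
    by (simp add: prod.Sigma)
  also have "\<dots> = (\<Prod>(i, j) \<in> {(i, j). i < j \<and> j < n}. of_nat (x j) - of_nat (x i))"
    by (rule prod.reindex_bij_witness[of _ prod.swap prod.swap]) (auto simp: u_def)
  finally show ?thesis
    by (simp add: u_def mult_ac)
qed

end
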